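(* If $P$ and $Q$ are nonempty finite sets of partitions, then the following are equivalent: (i) $\mathrm{cl}(P)=\mathrm{cl}(Q)$; (ii) $\mathrm{pr}(P)=\mathrm{pr}(Q)$; (iii) $\vee_P(\mu)=\vee_Q(\mu)$ for every partition $\mu$.
   Context: A partition is a weakly decreasing sequence $\sigma=(\sigma_1,\sigma_2,\ldots)$ of nonnegative integers with finitely many positive terms, with the convention $\sigma_\infty=0$, indices in $[1,\infty]$. Splicing: for partitions $\alpha,\beta$ and $i>0$ with $\alpha_i>\beta_{i+1}$ (strict), $\alpha\star_i\beta=(\alpha_1,\ldots,\alpha_i,\beta_{i+1},\beta_{i+2},\ldots)$; $\mathrm{cl}(P)$ is the closure of $P$ under splicing. Sum: $\mu+\alpha=(\mu_1+\alpha_1,\mu_2+\alpha_2,\ldots)$. $\alpha\vee\beta$ is the partition in which each positive integer has multiplicity equal to the maximum of its multiplicities in $\alpha$ and $\beta$; for finite nonempty $P=\{\alpha^{(1)},\ldots,\alpha^{(s)}\}$, $\vee_P(\mu)=(\mu+\alpha^{(1)})\vee\cdots\vee(\mu+\alpha^{(s)})$. The $p$-interval of $\sigma$ ($p\ge0$) is $\{i\in[1,\infty]:\sigma_i=p\}$. For finite nonempty $P$, $\mathrm{pr}_p(P)=\{(p,I):I$ is an inclusion-maximal element of the set of nonempty $p$-intervals of members of $P\}$, and the profile is $\mathrm{pr}(P)=\bigcup_{p\ge0}\mathrm{pr}_p(P)$. *)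

theory Defs
  imports "HOL-Library.Multiset" "HOL-Library.Extended_Nat"
begin

(* A partition (s_1, s_2, ...) is a function on nat, indexed from 1; the unused value at 0
   is fixed to be 0, so that equality of partitions is equality of functions. *)
definition is_partition :: "(nat \<Rightarrow> nat) \<Rightarrow> bool" where
  "is_partition \<sigma> \<longleftrightarrow>
     \<sigma> 0 = 0 \<and> (\<forall>i j. 1 \<le> i \<and> i \<le> j \<longrightarrow> \<sigma> j \<le> \<sigma> i) \<and> finite {i. \<sigma> i > 0}"

fun part :: "(nat \<Rightarrow> nat) \<Rightarrow> enat \<Rightarrow> nat" where
  "part \<sigma> (enat n) = \<sigma> n"
| "part \<sigma> \<infinity> = 0"

definition splice_at :: "nat \<Rightarrow> (nat \<Rightarrow> nat) \<Rightarrow> (nat \<Rightarrow> nat) \<Rightarrow> (nat \<Rightarrow> nat)" where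
  "splice_at i \<alpha> \<beta> = (\<lambda>j. if j \<le> i then \<alpha> j else \<beta> j)"

inductive_set cl :: "(nat \<Rightarrow> nat) set \<Rightarrow> (nat \<Rightarrow> nat) set" for P where
  base: "\<alpha> \<in> P \<Longrightarrow> \<alpha> \<in> cl P"
| splice: "\<lbrakk>\<alpha> \<in> cl P; \<beta> \<in> cl P; i > 0; \<alpha> i > \<beta> (i + 1)\<rbrakk> \<Longrightarrow> splice_at i \<alpha> \<beta> \<in> cl P"

definition psum :: "(nat \<Rightarrow> nat) \<Rightarrow> (nat \<Rightarrow> nat) \<Rightarrow> (nat \<Rightarrow> nat)" where
  "psum \<mu> \<alpha> = (\<lambda>i. \<mu> i + \<alpha> i)"

definition parts :: "(nat \<Rightarrow> nat) \<Rightarrow> nat multiset" where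
  "parts \<sigma> = image_mset \<sigma> (mset_set {i. \<sigma> i > 0})"

definition partition_of :: "nat multiset \<Rightarrow> (nat \<Rightarrow> nat)" where
  "partition_of M =
     (\<lambda>i. if 1 \<le> i \<and> i \<le> size M then rev (sorted_list_of_multiset M) ! (i - 1) else 0)"

(* The multiset operation used here takes the maximum of the multiplicities. *)
definition pjoin :: "(nat \<Rightarrow> nat) \<Rightarrow> (nat \<Rightarrow> nat) \<Rightarrow> (nat \<Rightarrow> nat)" where
  "pjoin \<alpha> \<beta> = partition_of (parts \<alpha> \<union># parts \<beta>)"

(* The join of all psum \<mu> \<alpha> with \<alpha> in P. Starting from the empty partition is harmless, since it
   is neutral for pjoin on partitions; see vee_singleton and vee_insert. *)
definition vee :: "(nat \<Rightarrow> nat) set \<Rightarrow> (nat \<Rightarrow> nat) \<Rightarrow> (nat \<Rightarrow> nat)" where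
  "vee P \<mu> = Finite_Set.fold (\<lambda>\<alpha>. pjoin (psum \<mu> \<alpha>)) (\<lambda>_. 0) P"

definition p_interval :: "nat \<Rightarrow> (nat \<Rightarrow> nat) \<Rightarrow> enat set" where
  "p_interval p \<sigma> = {i. 1 \<le> i \<and> part \<sigma> i = p}"

definition p_intervals :: "nat \<Rightarrow> (nat \<Rightarrow> nat) set \<Rightarrow> enat set set" where
  "p_intervals p P = {I. I \<noteq> {} \<and> (\<exists>\<sigma>\<in>P. I = p_interval p \<sigma>)}"

definition profile_at :: "nat \<Rightarrow> (nat \<Rightarrow> nat) set \<Rightarrow> (nat \<times> enat set) set" where
  "profile_at p P =
     {(p, I) |I. I \<in> p_intervals p P \<and> (\<forall>J\<in>p_intervals p P. I \<subseteq> J \<longrightarrow> J = I)}"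

definition profile :: "(nat \<Rightarrow> nat) set \<Rightarrow> (nat \<times> enat set) set" where
  "profile P = (\<Union>p. profile_at p P)"

lemma zero_notin_parts: "0 \<notin># parts \<sigma>"
  by (cases "finite {i. \<sigma> i > 0}") (auto simp: parts_def)

lemma is_partition_partition_of:
  "is_partition (partition_of M)"
proof -
  let ?xs = "rev (sorted_list_of_multiset M)"
  have len: "length ?xs = size M"
    by (metis length_rev mset_sorted_list_of_multiset size_mset)
  have "finite {i. partition_of M i > 0}"
    by (rule finite_subset[of _ "{..size M}"]) (auto simp: partition_of_def split: if_splits)
  moreover have "partition_of M j \<le> partition_of M i" if "1 \<le> i" "i \<le> j" for i j
  proof (cases "j \<le> size M")
    case True
    have "sorted_wrt (\<ge>) ?xs"
      by (simp add: sorted_wrt_rev)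
    then have "?xs ! (j - 1) \<le> ?xs ! (i - 1)"
      using that True len
      by (cases "i = j") (auto dest!: sorted_wrt_nth_less[of _ _ "i - 1" "j - 1"])
    then show ?thesis
      using that True by (simp add: partition_of_def)
  qed (use that in \<open>simp add: partition_of_def\<close>)
  ultimately show ?thesis
    by (auto simp: is_partition_def partition_of_def)
qed

lemma parts_partition_of:
  assumes "0 \<notin># M"
  shows "parts (partition_of M) = M"
proof -
  let ?xs = "rev (sorted_list_of_multiset M)"
  have ms: "mset ?xs = M"
    by simp
  have len: "length ?xs = size M"
    by (metis ms size_mset)
  have pos: "?xs ! i > 0" if "i < size M" for i
    using nth_mem[of i ?xs] that len assms by (metis ms gr0I set_mset_mset)
  have "{i. partition_of M i > 0} = Suc ` {..<size M}"
  proof (intro set_eqI iffI)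
    fix i assume "i \<in> {i. partition_of M i > 0}"
    then show "i \<in> Suc ` {..<size M}"
      by (cases i) (auto simp: partition_of_def split: if_splits)
  next
    fix i assume "i \<in> Suc ` {..<size M}"
    then show "i \<in> {i. partition_of M i > 0}"
      using pos by (auto simp: partition_of_def)
  qed
  then have "parts (partition_of M) = image_mset (partition_of M) (image_mset Suc (mset_set {..<size M}))"
    by (simp add: parts_def image_mset_mset_set)
  also have "\<dots> = image_mset (\<lambda>i. ?xs ! i) (mset_set {..<size M})"
    by (auto simp: partition_of_def image_mset.compositionality o_def intro!: image_mset_cong)
  also have "\<dots> = image_mset (\<lambda>i. ?xs ! i) (mset [0..<length ?xs])"
    by (simp add: len atLeast_upt[symmetric] lessThan_atLeast0 del: length_rev)
  also have "\<dots> = mset ?xs"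
    by (metis map_nth mset_map)
  finally show ?thesis using ms by simp
qed

lemma partition_eq_if_parts_eq:
  assumes "is_partition \<sigma>" "is_partition \<tau>" "parts \<sigma> = parts \<tau>"
  shows "\<sigma> = \<tau>"
proof -
  have canon: "\<exists>n. {i. \<sigma> i > 0} = Suc ` {..<n} \<and> sorted_wrt (\<ge>) (map (\<sigma> \<circ> Suc) [0..<n])
      \<and> mset (map (\<sigma> \<circ> Suc) [0..<n]) = parts \<sigma>" if p: "is_partition \<sigma>" for \<sigma>
  proof -
    have dec: "\<sigma> j \<le> \<sigma> i" if "1 \<le> i" "i \<le> j" for i j
      using p that by (auto simp: is_partition_def)
    have fin: "finite {i. \<sigma> i > 0}" and z: "\<sigma> 0 = 0"
      using p by (auto simp: is_partition_def)
    obtain m where m: "\<forall>i\<in>{i. \<sigma> i > 0}. i < m"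
      using fin finite_nat_set_iff_bounded by blast
    define n where "n = (LEAST n. \<sigma> (Suc n) = 0)"
    have ex: "\<sigma> (Suc m) = 0" using m by force
    have n0: "\<sigma> (Suc n) = 0" unfolding n_def using ex by (rule LeastI)
    have lt: "\<sigma> (Suc k) > 0" if "k < n" for k
      using not_less_Least[of k "\<lambda>n. \<sigma> (Suc n) = 0"] that unfolding n_def by auto
    have S: "{i. \<sigma> i > 0} = Suc ` {..<n}"
    proof (intro set_eqI iffI)
      fix i assume i: "i \<in> {i. \<sigma> i > 0}"
      then obtain k where k: "i = Suc k" using z by (cases i) auto
      have "k < n" using dec[of "Suc n" i] n0 i k by (cases "k < n") auto
      then show "i \<in> Suc ` {..<n}" using k by auto
    qed (use lt in auto)
    have "sorted_wrt (\<ge>) (map (\<sigma> \<circ> Suc) [0..<n])"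
      by (auto simp: sorted_wrt_iff_nth_less intro!: dec)
    moreover have "mset (map (\<sigma> \<circ> Suc) [0..<n]) = parts \<sigma>"
    proof -
      have "mset_set (Suc ` {..<n}) = image_mset Suc (mset_set {..<n})"
        by (rule image_mset_mset_set[symmetric]) simp
      then show ?thesis
        unfolding parts_def S by (simp add: multiset.map_comp lessThan_atLeast0)
    qed
    ultimately show ?thesis using S by blast
  qed
  obtain n where n: "{i. \<sigma> i > 0} = Suc ` {..<n}" "sorted_wrt (\<ge>) (map (\<sigma> \<circ> Suc) [0..<n])"
    "mset (map (\<sigma> \<circ> Suc) [0..<n]) = parts \<sigma>"
    using canon[OF assms(1)] by blast
  obtain n' where n': "{i. \<tau> i > 0} = Suc ` {..<n'}" "sorted_wrt (\<ge>) (map (\<tau> \<circ> Suc) [0..<n'])"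
    "mset (map (\<tau> \<circ> Suc) [0..<n']) = parts \<tau>"
    using canon[OF assms(2)] by blast
  have "mset (rev (map (\<sigma> \<circ> Suc) [0..<n])) = mset (rev (map (\<tau> \<circ> Suc) [0..<n']))"
    using n(3) n'(3) assms(3) by (simp only: mset_rev)
  moreover have "sorted (rev (map (\<sigma> \<circ> Suc) [0..<n]))" "sorted (rev (map (\<tau> \<circ> Suc) [0..<n']))"
    using n(2) n'(2) by (simp_all only: sorted_wrt_rev)
  ultimately have "rev (map (\<sigma> \<circ> Suc) [0..<n]) = rev (map (\<tau> \<circ> Suc) [0..<n'])"
    by (metis properties_for_sort)
  then have eq: "map (\<sigma> \<circ> Suc) [0..<n] = map (\<tau> \<circ> Suc) [0..<n']"
    by (simp only: rev_is_rev_conv)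
  then have nn: "n = n'"
    by (metis diff_zero length_map length_upt)
  show ?thesis
  proof
    fix i
    show "\<sigma> i = \<tau> i"
    proof (cases "i \<in> Suc ` {..<n}")
      case True
      then obtain k where "i = Suc k" "k < n" by auto
      moreover have "map (\<sigma> \<circ> Suc) [0..<n] ! k = map (\<tau> \<circ> Suc) [0..<n'] ! k"
        using eq by (rule arg_cong)
      ultimately show ?thesis using nn by simp
    next
      case False
      then have "i \<notin> {i. \<sigma> i > 0}" "i \<notin> {i. \<tau> i > 0}" unfolding n(1) n'(1) nn by -
      then show ?thesis by simp
    qed
  qed
qed

lemma partition_of_parts: "is_partition \<sigma> \<Longrightarrow> partition_of (parts \<sigma>) = \<sigma>"
  by (rule partition_eq_if_parts_eq)
    (simp_all add: is_partition_partition_of parts_partition_of zero_notin_parts)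

lemma parts_pjoin: "parts (pjoin \<alpha> \<beta>) = parts \<alpha> \<union># parts \<beta>"
  by (simp add: pjoin_def parts_partition_of zero_notin_parts)

lemma pjoin_left_commute: "pjoin \<alpha> (pjoin \<beta> \<gamma>) = pjoin \<beta> (pjoin \<alpha> \<gamma>)"
  unfolding pjoin_def[of _ "pjoin _ _"] parts_pjoin by (simp only: subset_mset.sup_left_commute)

lemma is_partition_pjoin: "is_partition (pjoin \<alpha> \<beta>)"
  by (simp add: pjoin_def is_partition_partition_of)

lemma count_parts:
  assumes "is_partition \<sigma>" "p > 0"
  shows "count (parts \<sigma>) p = card {i. \<sigma> i = p}"
proof -
  have "{i \<in> {i. \<sigma> i > 0}. p = \<sigma> i} = {i. \<sigma> i = p}"
    using assms(2) by auto
  then show ?thesis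
    using assms by (simp add: parts_def count_image_mset' is_partition_def)
qed

lemma count_parts_pjoin:
  "count (parts (pjoin \<alpha> \<beta>)) p = max (count (parts \<alpha>) p) (count (parts \<beta>) p)"
  by (simp add: parts_pjoin)

lemma is_partition_psum:
  assumes "is_partition \<mu>" "is_partition \<alpha>"
  shows "is_partition (psum \<mu> \<alpha>)"
proof -
  have "{i. psum \<mu> \<alpha> i > 0} = {i. \<mu> i > 0} \<union> {i. \<alpha> i > 0}"
    by (auto simp: psum_def)
  then show ?thesis
    using assms by (auto simp: is_partition_def psum_def intro!: add_mono)
qed

lemma vee_singleton:
  assumes "is_partition \<mu>" "is_partition \<alpha>"
  shows "vee {\<alpha>} \<mu> = psum \<mu> \<alpha>"
proof -
  interpret comp_fun_commute_on UNIV "\<lambda>\<alpha>. pjoin (psum \<mu> \<alpha>)"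
    by standard (rule ext, simp only: o_apply pjoin_left_commute)
  have "parts (\<lambda>_. 0) = {#}"
    by (simp add: parts_def)
  then show ?thesis
    using assms by (simp add: vee_def pjoin_def partition_of_parts is_partition_psum)
qed

lemma vee_insert:
  assumes "finite P" "\<alpha> \<notin> P"
  shows "vee (insert \<alpha> P) \<mu> = pjoin (psum \<mu> \<alpha>) (vee P \<mu>)"
proof -
  interpret comp_fun_commute_on UNIV "\<lambda>\<alpha>. pjoin (psum \<mu> \<alpha>)"
    by standard (rule ext, simp only: o_apply pjoin_left_commute)
  show ?thesis
    using assms by (simp add: vee_def)
qed

end

(* Each of the three conditions says that P and Q cover each other: every level set of a member of P
   lies in the level set, for the same value, of a member of Q, and conversely.
   For closures: a strict descent at the splicing index keeps the level sets of a splice inside level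
   sets of its two constituents, and conversely a partition is rebuilt by splicing, level by level,
   partitions that contain its level sets. For joins: mu + alpha is constant only where both mu and
   alpha are, so the multiplicities only depend on the covering relation, and a three-valued mu with
   large jumps isolates a given level set. *)
theory Submission
  imports Defs
begin

text \<open>The witness in \<open>Q\<close> may depend on the value \<open>p\<close> as well as on
  \<open>\<alpha>\<close>. Preimages live on \<open>nat\<close>, so they see the index 0 and not
  \<infinity>. If the preimage of \<open>p\<close> is empty, only a member of \<open>Q\<close> has
  to exist.\<close>

definition covers :: "(nat \<Rightarrow> nat) set \<Rightarrow> (nat \<Rightarrow> nat) set \<Rightarrow> bool" where
  "covers Q P \<longleftrightarrow> (\<forall>\<alpha>\<in>P. \<forall>p. \<exists>\<beta>\<in>Q. \<alpha> -` {p} \<subseteq> \<beta> -` {p})"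

section \<open>Elementary facts and uniform bounds for partitions\<close>

lemma partition_antimono: "is_partition \<sigma> \<Longrightarrow> 1 \<le> i \<Longrightarrow> i \<le> j \<Longrightarrow> \<sigma> j \<le> \<sigma> i"
  by (simp add: is_partition_def)

lemma partition_at_0: "is_partition \<sigma> \<Longrightarrow> \<sigma> 0 = 0"
  by (simp add: is_partition_def)

lemma partition_eventually_0:
  assumes "is_partition \<sigma>"
  obtains L where "\<And>i. i > L \<Longrightarrow> \<sigma> i = 0"
proof -
  have "finite {i. \<sigma> i > 0}"
    using assms by (simp add: is_partition_def)
  then obtain L where "\<forall>i\<in>{i. \<sigma> i > 0}. i \<le> L"
    using finite_nat_set_iff_bounded_le by blast
  then have "\<sigma> i = 0" if "i > L" for i
    using that by fastforce
  then show thesis using that by blast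
qed

lemma partition_le_first: "is_partition \<sigma> \<Longrightarrow> \<sigma> i \<le> \<sigma> 1"
  by (cases i) (auto simp: partition_at_0 intro: partition_antimono)

text \<open>Supplies the constants of the test partition in \<open>covers_if_vee_eq\<close>:
  \<open>N\<close> strictly exceeds all parts, and every member vanishes beyond
  \<open>L\<close>.\<close>

lemma finite_partitions_bounded:
  assumes "finite R" "\<forall>\<beta>\<in>R. is_partition \<beta>"
  shows "\<exists>N L. N > 0 \<and> (\<forall>\<beta>\<in>R. \<forall>i. \<beta> i < N \<and> (i > L \<longrightarrow> \<beta> i = 0))"
  using assms
proof (induction R)
  case empty
  then show ?case by auto
next
  case (insert \<sigma> R)
  then have "\<exists>N L. N > 0 \<and> (\<forall>\<beta>\<in>R. \<forall>i. \<beta> i < N \<and> (i > L \<longrightarrow> \<beta> i = 0))"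
    by simp
  then obtain N L where NL: "N > 0" "\<forall>\<beta>\<in>R. \<forall>i. \<beta> i < N \<and> (i > L \<longrightarrow> \<beta> i = 0)"
    by (elim exE conjE)
  obtain L' where L': "\<And>i. i > L' \<Longrightarrow> \<sigma> i = 0"
    using insert.prems partition_eventually_0 by blast
  have "\<beta> i < max N (Suc (\<sigma> 1)) \<and> (i > max L L' \<longrightarrow> \<beta> i = 0)" if "\<beta> \<in> insert \<sigma> R" for \<beta> i
    using that
  proof
    assume "\<beta> = \<sigma>"
    then show ?thesis
      using L' partition_le_first[of \<sigma> i] insert.prems by auto
  next
    assume "\<beta> \<in> R"
    then show ?thesis
      using NL(2) by (simp add: less_max_iff_disj)
  qed
  then show ?case
    by (intro exI[of _ "max N (Suc (\<sigma> 1))"] exI[of _ "max L L'"]) simp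
qed

section \<open>Profiles\<close>

text \<open>The two kinds of level set differ only at the indices 0 and \<infinity>. Every partition
  has the value 0 at both, so these indices cannot affect an inclusion.\<close>

lemma p_interval_subset_iff:
  assumes "is_partition \<alpha>" "is_partition \<beta>"
  shows "p_interval p \<alpha> \<subseteq> p_interval p \<beta> \<longleftrightarrow> \<alpha> -` {p} \<subseteq> \<beta> -` {p}"
proof
  assume sub: "p_interval p \<alpha> \<subseteq> p_interval p \<beta>"
  have "\<beta> i = p" if "\<alpha> i = p" for i
  proof (cases i)
    case 0
    then show ?thesis
      using that partition_at_0[OF assms(1)] partition_at_0[OF assms(2)] by simp
  next
    case (Suc k)
    then have "enat i \<in> p_interval p \<alpha>"
      using that by (auto simp: p_interval_def one_enat_def)
    then have "enat i \<in> p_interval p \<beta>" using sub by blast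
    then show ?thesis by (simp add: p_interval_def)
  qed
  then show "\<alpha> -` {p} \<subseteq> \<beta> -` {p}" by auto
next
  assume sub: "\<alpha> -` {p} \<subseteq> \<beta> -` {p}"
  show "p_interval p \<alpha> \<subseteq> p_interval p \<beta>"
  proof
    fix x assume x: "x \<in> p_interval p \<alpha>"
    then show "x \<in> p_interval p \<beta>"
      using sub by (cases x) (auto simp: p_interval_def)
  qed
qed

text \<open>\<open>p_intervals\<close> leaves out empty intervals. An empty interval is covered by
  any member of \<open>Q\<close>, and \<open>Q \<noteq> {}\<close> provides one.\<close>

lemma covers_iff_p_intervals:
  assumes "\<forall>\<alpha>\<in>P. is_partition \<alpha>" "\<forall>\<beta>\<in>Q. is_partition \<beta>" "Q \<noteq> {}"
  shows "covers Q P \<longleftrightarrow> (\<forall>p. \<forall>I\<in>p_intervals p P. \<exists>J\<in>p_intervals p Q. I \<subseteq> J)"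
proof
  assume cov: "covers Q P"
  show "\<forall>p. \<forall>I\<in>p_intervals p P. \<exists>J\<in>p_intervals p Q. I \<subseteq> J"
  proof (intro allI ballI)
    fix p I assume "I \<in> p_intervals p P"
    then obtain \<alpha> where \<alpha>: "\<alpha> \<in> P" "I = p_interval p \<alpha>" "I \<noteq> {}"
      by (auto simp: p_intervals_def)
    then obtain \<beta> where \<beta>: "\<beta> \<in> Q" "\<alpha> -` {p} \<subseteq> \<beta> -` {p}"
      using cov unfolding covers_def by blast
    then have "I \<subseteq> p_interval p \<beta>"
      using \<alpha>(1,2) assms(1,2) by (simp add: p_interval_subset_iff)
    moreover from this have "p_interval p \<beta> \<in> p_intervals p Q"
      using \<alpha>(3) \<beta>(1) by (auto simp: p_intervals_def)
    ultimately show "\<exists>J\<in>p_intervals p Q. I \<subseteq> J" ..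
  qed
next
  assume R: "\<forall>p. \<forall>I\<in>p_intervals p P. \<exists>J\<in>p_intervals p Q. I \<subseteq> J"
  show "covers Q P"
    unfolding covers_def
  proof (intro ballI allI)
    fix \<alpha> p assume \<alpha>: "\<alpha> \<in> P"
    have "\<exists>\<beta>\<in>Q. p_interval p \<alpha> \<subseteq> p_interval p \<beta>"
    proof (cases "p_interval p \<alpha> = {}")
      case True
      then show ?thesis using assms(3) by blast
    next
      case False
      then have "p_interval p \<alpha> \<in> p_intervals p P"
        using \<alpha> by (auto simp: p_intervals_def)
      then obtain J where "J \<in> p_intervals p Q" "p_interval p \<alpha> \<subseteq> J"
        using R by blast
      then show ?thesis by (auto simp: p_intervals_def)
    qed
    then show "\<exists>\<beta>\<in>Q. \<alpha> -` {p} \<subseteq> \<beta> -` {p}"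
      using \<alpha> assms(1,2) by (simp add: p_interval_subset_iff cong: bex_cong)
  qed
qed

lemma mem_profile_iff:
  "(p, I) \<in> profile P \<longleftrightarrow> I \<in> p_intervals p P \<and> (\<forall>J\<in>p_intervals p P. I \<subseteq> J \<longrightarrow> J = I)"
  by (auto simp: profile_def profile_at_def)

lemma finite_p_intervals:
  assumes "finite P"
  shows "finite (p_intervals p P)"
  by (rule finite_subset[OF _ finite_imageI[OF assms, of "p_interval p"]])
    (auto simp: p_intervals_def)

text \<open>In a finite family each interval lies below a maximal one. That maximal interval belongs
  to the profile of \<open>P\<close>, hence to that of \<open>Q\<close>.\<close>

lemma p_intervals_dominated_if_profile_subset:
  assumes "finite P" "profile P \<subseteq> profile Q" "I \<in> p_intervals p P"
  shows "\<exists>J\<in>p_intervals p Q. I \<subseteq> J"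
proof -
  obtain M where M: "M \<in> p_intervals p P" "I \<subseteq> M" "\<forall>J\<in>p_intervals p P. M \<subseteq> J \<longrightarrow> M = J"
    using finite_has_maximal2[OF finite_p_intervals[OF assms(1)] assms(3)] by blast
  then have "(p, M) \<in> profile P" unfolding mem_profile_iff by metis
  then have "(p, M) \<in> profile Q" using assms(2) by (rule rev_subsetD)
  then have "M \<in> p_intervals p Q" by (simp add: mem_profile_iff)
  then show ?thesis using M by blast
qed

text \<open>A maximal \<open>I\<close> of \<open>P\<close> lies in some \<open>J\<close> of
  \<open>Q\<close>, which lies in some \<open>K\<close> of \<open>P\<close>; maximality of
  \<open>I\<close> collapses the chain \<open>I \<subseteq> J \<subseteq> K\<close>.\<close>

lemma profile_subset_if_mutually_dominated:
  assumes "\<And>p I. I \<in> p_intervals p P \<Longrightarrow> \<exists>J\<in>p_intervals p Q. I \<subseteq> J"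
    and "\<And>p J. J \<in> p_intervals p Q \<Longrightarrow> \<exists>I\<in>p_intervals p P. J \<subseteq> I"
  shows "profile P \<subseteq> profile Q"
proof
  fix x assume x: "x \<in> profile P"
  obtain p I where pI: "x = (p, I)" by force
  have I: "I \<in> p_intervals p P" "\<And>J. J \<in> p_intervals p P \<Longrightarrow> I \<subseteq> J \<Longrightarrow> J = I"
    using x unfolding pI mem_profile_iff by blast+
  \<comment> \<open>This serves twice: a \<open>J\<close> above \<open>I\<close> exists, so
    \<open>I\<close> itself is an interval of \<open>Q\<close>; and no larger one exists, so it is
    maximal there.\<close>
  have squeeze: "J = I" if J: "J \<in> p_intervals p Q" "I \<subseteq> J" for J
  proof -
    obtain K where K: "K \<in> p_intervals p P" "J \<subseteq> K" using assms(2) J(1) by blast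
    then have "K = I" using I(2) J(2) by blast
    then show ?thesis using K(2) J(2) by blast
  qed
  moreover obtain J where "J \<in> p_intervals p Q" "I \<subseteq> J"
    using assms(1)[OF I(1)] by blast
  then have "I \<in> p_intervals p Q"
    using squeeze by metis
  ultimately show "x \<in> profile Q"
    unfolding pI mem_profile_iff by blast
qed

lemma profile_eq_iff_covers:
  assumes P: "finite P" "P \<noteq> {}" "\<forall>\<alpha>\<in>P. is_partition \<alpha>"
    and Q: "finite Q" "Q \<noteq> {}" "\<forall>\<beta>\<in>Q. is_partition \<beta>"
  shows "profile P = profile Q \<longleftrightarrow> covers Q P \<and> covers P Q"
proof
  assume eq: "profile P = profile Q"
  then show "covers Q P \<and> covers P Q"
    unfolding covers_iff_p_intervals[OF P(3) Q(3) Q(2)] covers_iff_p_intervals[OF Q(3) P(3) P(2)]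
    by (intro conjI allI ballI p_intervals_dominated_if_profile_subset[OF P(1)]
        p_intervals_dominated_if_profile_subset[OF Q(1)]) auto
next
  assume "covers Q P \<and> covers P Q"
  then have "\<And>p I. I \<in> p_intervals p P \<Longrightarrow> \<exists>J\<in>p_intervals p Q. I \<subseteq> J"
    and "\<And>p J. J \<in> p_intervals p Q \<Longrightarrow> \<exists>I\<in>p_intervals p P. J \<subseteq> I"
    unfolding covers_iff_p_intervals[OF P(3) Q(3) Q(2)] covers_iff_p_intervals[OF Q(3) P(3) P(2)]
    by blast+
  then show "profile P = profile Q"
    by (intro subset_antisym profile_subset_if_mutually_dominated)
qed

section \<open>Closures\<close>

lemma is_partition_splice_at:
  assumes "is_partition \<alpha>" "is_partition \<beta>" "i > 0" "\<beta> (i + 1) < \<alpha> i"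
  shows "is_partition (splice_at i \<alpha> \<beta>)"
proof -
  have "splice_at i \<alpha> \<beta> l \<le> splice_at i \<alpha> \<beta> k" if kl: "1 \<le> k" "k \<le> l" for k l
  proof (cases "k \<le> i \<and> i < l")
    case True
    then have "\<beta> l \<le> \<beta> (i + 1)" "\<alpha> i \<le> \<alpha> k"
      using kl assms partition_antimono[of \<beta> "i + 1" l] partition_antimono[of \<alpha> k i] by auto
    then show ?thesis
      using True assms(4) by (auto simp: splice_at_def)
  next
    case False
    then show ?thesis
      using kl partition_antimono[OF assms(1), of k l] partition_antimono[OF assms(2), of k l]
      by (auto simp: splice_at_def)
  qed
  moreover have "finite {k. splice_at i \<alpha> \<beta> k > 0}"
    by (rule finite_subset[of _ "{k. \<alpha> k > 0} \<union> {k. \<beta> k > 0}"])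
      (use assms in \<open>auto simp: splice_at_def is_partition_def\<close>)
  ultimately show ?thesis
    using assms(1) by (auto simp: is_partition_def splice_at_def)
qed

text \<open>If \<open>\<alpha> i \<le> p\<close>, the tail stays at or below
  \<open>\<beta> (i + 1) < \<alpha> i \<le> p\<close>, so \<open>p\<close> occurs only in the part
  taken from \<open>\<alpha>\<close>. If \<open>\<alpha> i > p\<close>, the head exceeds
  \<open>p\<close> at all positive indices, so \<open>p\<close> occurs there only in the part taken
  from \<open>\<beta>\<close>.\<close>

lemma splice_at_level_subset:
  assumes "is_partition \<alpha>" "is_partition \<beta>" "i > 0" "\<beta> (i + 1) < \<alpha> i"
  shows "splice_at i \<alpha> \<beta> -` {p} \<subseteq> \<alpha> -` {p} \<or> splice_at i \<alpha> \<beta> -` {p} \<subseteq> \<beta> -` {p}"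
proof (cases "\<alpha> i \<le> p")
  case True
  have "j \<le> i" if "splice_at i \<alpha> \<beta> j = p" for j
    using partition_antimono[OF assms(2), of "i + 1" j] that assms(4) True
    by (simp add: splice_at_def split: if_splits)
  then have "splice_at i \<alpha> \<beta> -` {p} \<subseteq> \<alpha> -` {p}"
    by (fastforce simp: splice_at_def)
  then show ?thesis ..
next
  case False
  \<comment> \<open>Monotonicity starts at index 1, so index 0 survives; both partitions vanish
    there.\<close>
  have "j = 0" if "j \<le> i" "\<alpha> j = p" for j
    using partition_antimono[OF assms(1), of j i] that False by (cases j) auto
  then have "splice_at i \<alpha> \<beta> -` {p} \<subseteq> \<beta> -` {p}"
    using partition_at_0[OF assms(1)] partition_at_0[OF assms(2)]
    by (fastforce simp: splice_at_def split: if_splits)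
  then show ?thesis ..
qed

lemma is_partition_cl:
  assumes "\<sigma> \<in> cl P" "\<forall>\<alpha>\<in>P. is_partition \<alpha>"
  shows "is_partition \<sigma>"
  using assms by induction (auto intro: is_partition_splice_at)

text \<open>Each splice keeps a given level inside a level of one constituent. Which constituent it
  is may change with \<open>p\<close>, as the covering relation allows.\<close>

lemma covers_cl:
  assumes "\<forall>\<alpha>\<in>P. is_partition \<alpha>"
  shows "covers P (cl P)"
proof -
  have "\<forall>p. \<exists>\<beta>\<in>P. \<sigma> -` {p} \<subseteq> \<beta> -` {p}" if "\<sigma> \<in> cl P" for \<sigma>
    using that
  proof induction
    case (base \<alpha>)
    then show ?case by blast
  next
    case (splice \<alpha> \<beta> i)
    show ?case
    proof
      fix p
      have "splice_at i \<alpha> \<beta> -` {p} \<subseteq> \<alpha> -` {p} \<or> splice_at i \<alpha> \<beta> -` {p} \<subseteq> \<beta> -` {p}"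
        using splice.hyps assms by (intro splice_at_level_subset is_partition_cl) auto
      then show "\<exists>\<gamma>\<in>P. splice_at i \<alpha> \<beta> -` {p} \<subseteq> \<gamma> -` {p}"
        using splice.IH by (meson order_trans)
    qed
  qed
  then show ?thesis by (simp add: covers_def)
qed

lemma cl_subset_cl:
  assumes "P \<subseteq> cl Q"
  shows "cl P \<subseteq> cl Q"
proof
  fix \<sigma> assume "\<sigma> \<in> cl P"
  then show "\<sigma> \<in> cl Q"
    by induction (use assms in \<open>auto intro: cl.splice\<close>)
qed

text \<open>The partition \<alpha> is rebuilt from left to right: at each strict descent, the member
  of \<open>Q\<close> covering the next level is spliced in.\<close>

lemma mem_cl_if_levels_covered:
  assumes "is_partition \<alpha>" "\<forall>\<beta>\<in>Q. is_partition \<beta>"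
    and "\<And>p. \<exists>\<beta>\<in>Q. \<alpha> -` {p} \<subseteq> \<beta> -` {p}"
  shows "\<alpha> \<in> cl Q"
proof -
  \<comment> \<open>Agreement is kept on the whole current level as well as on the prefix. Thus no
    splice is made inside a level, where the strict inequality would fail.\<close>
  have step: "\<exists>\<gamma>\<in>cl Q. \<forall>j. j \<le> Suc n \<or> \<alpha> j = \<alpha> (Suc n) \<longrightarrow> \<gamma> j = \<alpha> j" for n
  proof (induction n)
    case 0
    obtain \<beta> where "\<beta> \<in> Q" "\<alpha> -` {\<alpha> 1} \<subseteq> \<beta> -` {\<alpha> 1}" using assms(3) by blast
    moreover from this have "\<beta> 0 = \<alpha> 0"
      using assms(1,2) by (simp add: partition_at_0)
    ultimately show ?case
      by (intro bexI[of _ \<beta>] cl.base) (auto simp: le_Suc_eq)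
  next
    case (Suc n)
    let ?i = "Suc n"
    obtain \<gamma> where \<gamma>: "\<gamma> \<in> cl Q" "\<And>j. j \<le> ?i \<or> \<alpha> j = \<alpha> ?i \<Longrightarrow> \<gamma> j = \<alpha> j"
      using Suc.IH by blast
    show ?case
    proof (cases "\<alpha> (Suc ?i) = \<alpha> ?i")
      case True
      then show ?thesis using \<gamma> by (metis le_Suc_eq)
    next
      case False
      then have less: "\<alpha> (Suc ?i) < \<alpha> ?i"
        using partition_antimono[OF assms(1), of ?i "Suc ?i"] by simp
      obtain \<beta> where \<beta>: "\<beta> \<in> Q" "\<alpha> -` {\<alpha> (Suc ?i)} \<subseteq> \<beta> -` {\<alpha> (Suc ?i)}"
        using assms(3) by blast
      then have \<beta>': "\<beta> j = \<alpha> j" if "\<alpha> j = \<alpha> (Suc ?i)" for j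
        using that by auto
      \<comment> \<open>Both values at the junction are those of \<alpha>, so its strict descent is
        the splicing condition.\<close>
      have "splice_at ?i \<gamma> \<beta> \<in> cl Q"
        using \<gamma> \<beta>' less by (intro cl.splice cl.base[OF \<beta>(1)]) simp_all
      moreover have "splice_at ?i \<gamma> \<beta> j = \<alpha> j" if "j \<le> Suc ?i \<or> \<alpha> j = \<alpha> (Suc ?i)" for j
        using that \<gamma>(2)[of j] \<beta>'[of j] by (auto simp: splice_at_def le_Suc_eq)
      ultimately show ?thesis by blast
    qed
  qed
  obtain L where L: "\<And>i. i > L \<Longrightarrow> \<alpha> i = 0"
    using partition_eventually_0[OF assms(1)] by blast
  \<comment> \<open>Index \<open>Suc L\<close> is in the zero level, so the invariant there also
    controls the infinite tail.\<close>
  obtain \<gamma> where \<gamma>: "\<gamma> \<in> cl Q" "\<And>j. j \<le> Suc L \<or> \<alpha> j = \<alpha> (Suc L) \<Longrightarrow> \<gamma> j = \<alpha> j"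
    using step by blast
  have "\<gamma> j = \<alpha> j" for j
    using \<gamma>(2)[of j] L[of j] L[of "Suc L"] by (cases "j \<le> Suc L") auto
  then have "\<gamma> = \<alpha>" by blast
  then show ?thesis using \<gamma>(1) by simp
qed

lemma cl_subset_iff_covers:
  assumes "\<forall>\<alpha>\<in>P. is_partition \<alpha>" "\<forall>\<beta>\<in>Q. is_partition \<beta>"
  shows "cl P \<subseteq> cl Q \<longleftrightarrow> covers Q P"
proof
  assume "cl P \<subseteq> cl Q"
  then have "P \<subseteq> cl Q" using cl.base by blast
  then show "covers Q P" using covers_cl[OF assms(2)] by (auto simp: covers_def)
next
  assume "covers Q P"
  then have "P \<subseteq> cl Q"
    using assms by (auto simp: covers_def intro!: mem_cl_if_levels_covered)
  then show "cl P \<subseteq> cl Q" by (rule cl_subset_cl)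
qed

section \<open>Joins\<close>

text \<open>Reduces equality of joins to a comparison of maximal level sizes, since a partition is
  determined by the multiplicities of its positive parts.\<close>

lemma vee_is_partition_and_count:
  assumes "finite P" "P \<noteq> {}" "\<forall>\<alpha>\<in>P. is_partition \<alpha>" "is_partition \<mu>" "m > 0"
  shows "is_partition (vee P \<mu>) \<and>
    count (parts (vee P \<mu>)) m = Max ((\<lambda>\<alpha>. card {i. psum \<mu> \<alpha> i = m}) ` P)"
  using assms(1-3)
proof (induction rule: finite_ne_induct)
  case (singleton \<alpha>)
  then show ?case
    using assms by (simp add: vee_singleton is_partition_psum count_parts)
next
  case (insert \<alpha> P)
  then show ?case
    using assms
    by (simp add: vee_insert is_partition_pjoin is_partition_psum count_parts count_parts_pjoin)
qed

lemma finite_psum_level: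
  assumes "is_partition \<mu>" "is_partition \<alpha>" "m > 0"
  shows "finite {i. psum \<mu> \<alpha> i = m}"
  by (rule finite_subset[of _ "{i. psum \<mu> \<alpha> i > 0}"])
    (use is_partition_psum[OF assms(1,2)] assms(3) in \<open>auto simp: is_partition_def\<close>)

text \<open>Two weakly decreasing sequences whose sum agrees at two positive indices must each agree
  there. Hence a nonempty level of the sum lies in a single level of \<alpha>, whose value is the
  \<open>p\<close> sought; it is chosen independently of \<beta>.\<close>

lemma psum_level_subset:
  assumes "is_partition \<mu>" "is_partition \<alpha>" "m > 0"
  obtains p where "\<And>\<beta>. \<alpha> -` {p} \<subseteq> \<beta> -` {p} \<Longrightarrow> {i. psum \<mu> \<alpha> i = m} \<subseteq> {i. psum \<mu> \<beta> i = m}"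
proof (cases "{i. psum \<mu> \<alpha> i = m} = {}")
  case True
  then show thesis using that by simp
next
  case False
  then obtain k where k: "\<mu> k + \<alpha> k = m" by (auto simp: psum_def)
  have const: "\<alpha> i = \<alpha> k" if "\<mu> i + \<alpha> i = m" for i
  proof -
    \<comment> \<open>The sum is 0 at index 0, while \<open>m > 0\<close>; so monotonicity is
      available at both indices.\<close>
    have "1 \<le> i" "1 \<le> k"
      using that k assms(3) partition_at_0[OF assms(1)] partition_at_0[OF assms(2)]
      by (auto simp: Suc_le_eq intro!: gr0I)
    then show ?thesis
      using that k partition_antimono[OF assms(1), of i k] partition_antimono[OF assms(2), of i k]
        partition_antimono[OF assms(1), of k i] partition_antimono[OF assms(2), of k i]
      by (cases "i \<le> k") auto
  qed
  have "{i. psum \<mu> \<alpha> i = m} \<subseteq> {i. psum \<mu> \<beta> i = m}" if "\<alpha> -` {\<alpha> k} \<subseteq> \<beta> -` {\<alpha> k}" for \<beta>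
  proof
    fix i assume "i \<in> {i. psum \<mu> \<alpha> i = m}"
    then have "\<mu> i + \<alpha> i = m" by (simp add: psum_def)
    moreover from this have "\<alpha> i = \<alpha> k" by (rule const)
    moreover from this have "\<beta> i = \<alpha> k" using that by auto
    ultimately show "i \<in> {i. psum \<mu> \<beta> i = m}" by (simp add: psum_def)
  qed
  then show thesis using that by blast
qed

text \<open>For each \<alpha>, a single value \<open>p\<close> decides which \<beta> from the
  covering contains the entire level of the sum. These levels are finite because
  \<open>m > 0\<close>, so inclusion bounds cardinalities.\<close>

lemma count_vee_le_if_covers:
  assumes P: "finite P" "P \<noteq> {}" "\<forall>\<alpha>\<in>P. is_partition \<alpha>"
    and Q: "finite Q" "Q \<noteq> {}" "\<forall>\<beta>\<in>Q. is_partition \<beta>"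
    and \<mu>: "is_partition \<mu>" and m: "m > 0" and cov: "covers Q P"
  shows "count (parts (vee P \<mu>)) m \<le> count (parts (vee Q \<mu>)) m"
proof -
  have "\<exists>\<beta>\<in>Q. card {i. psum \<mu> \<alpha> i = m} \<le> card {i. psum \<mu> \<beta> i = m}" if \<alpha>: "\<alpha> \<in> P" for \<alpha>
  proof -
    have "is_partition \<alpha>" using \<alpha> P(3) by blast
    then obtain p where
      p: "\<And>\<beta>. \<alpha> -` {p} \<subseteq> \<beta> -` {p} \<Longrightarrow> {i. psum \<mu> \<alpha> i = m} \<subseteq> {i. psum \<mu> \<beta> i = m}"
      using psum_level_subset[OF \<mu> _ m] by blast
    obtain \<beta> where "\<beta> \<in> Q" "\<alpha> -` {p} \<subseteq> \<beta> -` {p}"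
      using cov \<alpha> unfolding covers_def by blast
    then show ?thesis
      using p finite_psum_level[OF \<mu> _ m] Q(3) by (blast intro: card_mono)
  qed
  then have "Max ((\<lambda>\<alpha>. card {i. psum \<mu> \<alpha> i = m}) ` P) \<le> Max ((\<lambda>\<alpha>. card {i. psum \<mu> \<alpha> i = m}) ` Q)"
    using P(1,2) Q(1,2) by (intro Max.boundedI) (auto simp add: Max_ge_iff simp del: not_le)
  then show ?thesis
    using vee_is_partition_and_count[OF P \<mu> m] vee_is_partition_and_count[OF Q \<mu> m] by simp
qed

lemma vee_eq_if_covers:
  assumes P: "finite P" "P \<noteq> {}" "\<forall>\<alpha>\<in>P. is_partition \<alpha>"
    and Q: "finite Q" "Q \<noteq> {}" "\<forall>\<beta>\<in>Q. is_partition \<beta>"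
    and \<mu>: "is_partition \<mu>" and cov: "covers Q P" "covers P Q"
  shows "vee P \<mu> = vee Q \<mu>"
proof (rule partition_eq_if_parts_eq)
  show "is_partition (vee P \<mu>)" "is_partition (vee Q \<mu>)"
    using vee_is_partition_and_count[OF P \<mu> zero_less_one]
      vee_is_partition_and_count[OF Q \<mu> zero_less_one] by simp_all
  show "parts (vee P \<mu>) = parts (vee Q \<mu>)"
  proof (rule multiset_eqI)
    fix m
    show "count (parts (vee P \<mu>)) m = count (parts (vee Q \<mu>)) m"
    proof (cases "m = 0")
      case True
      then show ?thesis
        using zero_notin_parts by (simp add: not_in_iff)
    next
      case False
      then show ?thesis
        using count_vee_le_if_covers[OF P Q \<mu> _ cov(1)] count_vee_le_if_covers[OF Q P \<mu> _ cov(2)]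
        by (simp add: order_antisym)
    qed
  qed
qed

text \<open>For fixed \<alpha> and \<open>p\<close>, a suitable \<mu> makes the multiplicity of
  \<open>N + p\<close> count how much of \<open>S\<close> a partition sends to \<open>p\<close>.
  Since \<alpha> attains the full count \<open>card S\<close>, equality of the joins forces some
  member of \<open>Q\<close> to attain it too.\<close>

lemma covers_if_vee_eq:
  assumes P: "finite P" "P \<noteq> {}" "\<forall>\<alpha>\<in>P. is_partition \<alpha>"
    and Q: "finite Q" "Q \<noteq> {}" "\<forall>\<beta>\<in>Q. is_partition \<beta>"
    and eq: "\<And>\<mu>. is_partition \<mu> \<Longrightarrow> vee P \<mu> = vee Q \<mu>"
  shows "covers Q P"
  unfolding covers_def
proof (intro ballI allI)
  fix \<alpha> p assume \<alpha>: "\<alpha> \<in> P"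
  have \<alpha>': "is_partition \<alpha>" using \<alpha> P(3) by blast
  have "finite (P \<union> Q)" "\<forall>\<beta>\<in>P \<union> Q. is_partition \<beta>"
    using P(1,3) Q(1,3) by auto
  then obtain N L where N: "N > 0" and NL: "\<forall>\<beta>\<in>P \<union> Q. \<forall>i. \<beta> i < N \<and> (i > L \<longrightarrow> \<beta> i = 0)"
    using finite_partitions_bounded by metis
  have less_N: "\<beta> i < N" if "\<beta> \<in> P \<union> Q" for \<beta> i
    using NL that by simp
  have L: "\<beta> i = 0" if "\<beta> \<in> P \<union> Q" "i > L" for \<beta> i
    using NL that by simp
  (* The 0-interval is infinite, so S is truncated where all members of P and Q vanish. *)
  define S where "S = {i. 1 \<le> i \<and> i \<le> L \<and> \<alpha> i = p}"
  \<comment> \<open>Indices with parts above \<open>p\<close> precede \<open>S\<close>, so the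
    heights \<open>2 * N\<close>, \<open>N\<close>, 0 decrease. Gaps of \<open>N\<close> exceed
    every part and keep the three bands of sums apart.\<close>
  define \<mu> where "\<mu> i = (if i = 0 then 0 else if p < \<alpha> i then 2 * N else if i \<in> S then N else 0)" for i
  have fS: "finite S"
    by (rule finite_subset[of _ "{..L}"]) (auto simp: S_def)
  have \<mu>: "is_partition \<mu>"
    unfolding is_partition_def
  proof (intro conjI allI impI)
    show "\<mu> 0 = 0" by (simp add: \<mu>_def)
    fix i j :: nat assume "1 \<le> i \<and> i \<le> j"
    then show "\<mu> j \<le> \<mu> i"
      using partition_antimono[OF \<alpha>', of i j] by (auto simp: \<mu>_def S_def)
  next
    show "finite {i. \<mu> i > 0}"
      by (rule finite_subset[of _ "{i. \<alpha> i > 0} \<union> S"])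
        (use \<alpha>' fS in \<open>auto simp: \<mu>_def is_partition_def split: if_splits\<close>)
  qed
  \<comment> \<open>At height \<open>2 * N\<close> one has \<open>p < \<alpha> i < N\<close>, so the
    sum exceeds \<open>N + p\<close>; at height 0 the sum is below \<open>N\<close>. Only height
    \<open>N\<close> remains, where the part must be \<open>p\<close>.\<close>
  have level: "{i. psum \<mu> \<beta> i = N + p} = {i \<in> S. \<beta> i = p}" if \<beta>: "\<beta> \<in> P \<union> Q" for \<beta>
  proof -
    have "\<mu> i + \<beta> i = N + p \<longleftrightarrow> i \<in> S \<and> \<beta> i = p" for i
    proof (cases "i = 0")
      case True
      moreover have "\<beta> 0 = 0" using \<beta> P(3) Q(3) partition_at_0 by blast
      ultimately show ?thesis using N by (simp add: \<mu>_def S_def)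
    next
      case False
      then show ?thesis
        using less_N[OF \<beta>, of i] less_N[of \<alpha> i] \<alpha> by (auto simp: \<mu>_def S_def)
    qed
    then show ?thesis by (simp add: psum_def)
  qed
  have m: "N + p > 0" using N by simp
  have "Max ((\<lambda>\<alpha>. card {i. psum \<mu> \<alpha> i = N + p}) ` P) = Max ((\<lambda>\<beta>. card {i. psum \<mu> \<beta> i = N + p}) ` Q)"
    using vee_is_partition_and_count[OF P \<mu> m] vee_is_partition_and_count[OF Q \<mu> m] eq[OF \<mu>] by simp
  moreover have "card {i. psum \<mu> \<alpha> i = N + p} \<le> Max ((\<lambda>\<alpha>. card {i. psum \<mu> \<alpha> i = N + p}) ` P)"
    using P(1) \<alpha> by (intro Max_ge) auto
  moreover have "{i \<in> S. \<alpha> i = p} = S" by (auto simp: S_def)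
  ultimately have "card S \<le> Max ((\<lambda>\<beta>. card {i. psum \<mu> \<beta> i = N + p}) ` Q)"
    using level[of \<alpha>] \<alpha> by simp
  \<comment> \<open>A maximizing \<beta> takes the value \<open>p\<close> on at least
    \<open>card S\<close> elements of the finite set \<open>S\<close>, hence on all of it.\<close>
  then obtain \<beta> where \<beta>: "\<beta> \<in> Q" "card S \<le> card {i \<in> S. \<beta> i = p}"
    using Q(1,2) level by (auto simp: Max_ge_iff)
  then have "{i \<in> S. \<beta> i = p} = S"
    by (intro card_seteq[OF fS]) auto
  then have inS: "\<beta> i = p" if "i \<in> S" for i using that by blast
  \<comment> \<open>Truncation lost only index 0 and the indices beyond \<open>L\<close>. Both
    \<alpha> and \<beta> vanish there, so such an index can occur only for
    \<open>p = 0\<close>.\<close>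
  have "\<beta> i = p" if i: "\<alpha> i = p" for i
  proof (cases "i \<in> S")
    case False
    then consider "i = 0" | "i > L" using i by (fastforce simp: S_def)
    then show ?thesis
    proof cases
      case 1
      have "is_partition \<beta>" using \<beta>(1) Q(3) by blast
      then show ?thesis using i 1 partition_at_0[OF \<alpha>'] by (simp add: partition_at_0)
    next
      case 2
      then show ?thesis using i 2 L[of \<alpha> i] L[of \<beta> i] \<alpha> \<beta>(1) by simp
    qed
  qed (rule inS)
  then show "\<exists>\<beta>\<in>Q. \<alpha> -` {p} \<subseteq> \<beta> -` {p}"
    using \<beta>(1) by blast
qed

section \<open>The three conditions compared through mutual covering\<close>

theorem theorem4p4:
  fixes P Q :: "(nat \<Rightarrow> nat) set"
  assumes "finite P" and "P \<noteq> {}" and "\<forall>\<alpha>\<in>P. is_partition \<alpha>"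
    and "finite Q" and "Q \<noteq> {}" and "\<forall>\<beta>\<in>Q. is_partition \<beta>"
  shows "(cl P = cl Q \<longleftrightarrow> profile P = profile Q) \<and>
    (profile P = profile Q \<longleftrightarrow> (\<forall>\<mu>. is_partition \<mu> \<longrightarrow> vee P \<mu> = vee Q \<mu>))"
proof -
  have "cl P = cl Q \<longleftrightarrow> covers Q P \<and> covers P Q"
    unfolding set_eq_subset using assms by (simp add: cl_subset_iff_covers)
  moreover have "profile P = profile Q \<longleftrightarrow> covers Q P \<and> covers P Q"
    using assms by (rule profile_eq_iff_covers)
  moreover have "(\<forall>\<mu>. is_partition \<mu> \<longrightarrow> vee P \<mu> = vee Q \<mu>) \<longleftrightarrow> covers Q P \<and> covers P Q"
  proof
    assume eq: "\<forall>\<mu>. is_partition \<mu> \<longrightarrow> vee P \<mu> = vee Q \<mu>"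
    have "covers Q P"
      by (rule covers_if_vee_eq[OF assms]) (rule eq[rule_format])
    moreover have "covers P Q"
      by (rule covers_if_vee_eq[OF assms(4-6) assms(1-3)]) (rule eq[rule_format, symmetric])
    ultimately show "covers Q P \<and> covers P Q" ..
  qed (intro allI impI, elim conjE, rule vee_eq_if_covers[OF assms])
  ultimately show ?thesis by blast
qed

end
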